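(* Let $(B,L)$ and $(F,G)$ be Hadamard pairs of sets of integers with the same scaling factor $R$, such that $bg$ is a multiple of $R$ for every $b\in B$ and $g\in G$. Then $(B\oplus F,L\oplus G)$ is a Hadamard pair with scaling factor $R$.
   Context: Hadamard pair: for an integer $R\ge2$ and finite sets $B,L\subset\mathbb{Z}$ with $0\in B$, $0\in L$, $(B,L)$ is a Hadamard pair with scaling factor $R$ if $\#B=\#L=N$ and the matrix $\frac{1}{\sqrt N}\left(e^{2\pi i R^{-1}bl}\right)_{b\in B,l\in L}$ is unitary. The two pairs $(B,L)$ and $(F,G)$ may have different sizes. Direct sum: sets $A,A'\subset\mathbb{R}$ have disjoint differences if $(A-A)\cap(A'-A')=\{0\}$; in this case $A\oplus A'=\{a+a':a\in A,a'\in A'\}$, so that every element of $A\oplus A'$ is uniquely of the form $a+a'$ (the sign $\oplus$ asserts disjoint differences). *)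

theory Defs
  imports Complex_Main "HOL-Library.Set_Algebras"
begin

(* The matrix with rows indexed by I and columns by J is square and M M^* = M^* M = Id. *)
definition unitary_on :: "'a set \<Rightarrow> 'b set \<Rightarrow> ('a \<Rightarrow> 'b \<Rightarrow> complex) \<Rightarrow> bool" where
  "unitary_on I J M \<longleftrightarrow>
     finite I \<and> finite J \<and> card I = card J \<and>
     (\<forall>i\<in>I. \<forall>i'\<in>I. (\<Sum>j\<in>J. M i j * cnj (M i' j)) = (if i = i' then 1 else 0)) \<and>
     (\<forall>j\<in>J. \<forall>j'\<in>J. (\<Sum>i\<in>I. cnj (M i j) * M i j') = (if j = j' then 1 else 0))"

definition hadamard_matrix :: "int \<Rightarrow> nat \<Rightarrow> int \<Rightarrow> int \<Rightarrow> complex" where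
  "hadamard_matrix R N b l =
     1 / complex_of_real (sqrt (real N)) *
       exp (2 * complex_of_real pi * \<i> * inverse (of_int R) * of_int b * of_int l)"

definition hadamard_pair :: "int \<Rightarrow> int set \<Rightarrow> int set \<Rightarrow> bool" where
  "hadamard_pair R B L \<longleftrightarrow>
     R \<ge> 2 \<and> finite B \<and> finite L \<and> 0 \<in> B \<and> 0 \<in> L \<and> card B = card L \<and>
     unitary_on B L (hadamard_matrix R (card B))"

definition difference_set :: "'a::ab_group_add set \<Rightarrow> 'a set" where
  "difference_set A = {a - a' | a a'. a \<in> A \<and> a' \<in> A}"

(* The direct sum of A and A' is the elementwise sum A + A' of Set_Algebras, defined only when
   A and A' have disjoint differences; hence "A \<oplus> A' has P" reads
   disjoint_differences A A' together with P (A + A'). *)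
definition disjoint_differences :: "'a::ab_group_add set \<Rightarrow> 'a set \<Rightarrow> bool" where
  "disjoint_differences A A' \<longleftrightarrow> difference_set A \<inter> difference_set A' = {0}"

end

theory Submission
  imports Defs
begin

text \<open>Unitarity says that the exponential sums \<open>\<Sum>l\<in>L. e((b - b') l)\<close> with
  \<open>e(n) = exp(2 \<pi> \<i> n / R)\<close>
  vanish for \<open>b \<noteq> b'\<close>, together with the dual condition. Since \<open>e(b g) = 1\<close>, the sum for
  \<open>(B + F, L + G)\<close> splits as
  \<open>(\<Sum>l\<in>L. e((b - b' + f - f') l)) * (\<Sum>g\<in>G. e((f - f') g))\<close>; the second factor vanishes unless
  \<open>f = f'\<close>, and then the first one is the sum for \<open>(B, L)\<close>. A common difference \<open>b - b' = f - f'\<close>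
  gives \<open>e((f - f') g) = 1\<close> on all of \<open>G\<close>, so the sum cannot vanish and \<open>f = f'\<close>. The dual statements
  follow by exchanging \<open>(B, L)\<close> with \<open>(G, F)\<close> and \<open>(F, G)\<close> with \<open>(L, B)\<close>.\<close>

definition additive_char :: "int \<Rightarrow> int \<Rightarrow> complex" where
  "additive_char R n = cis (2 * pi * (real_of_int n / real_of_int R))"

lemma additive_char_0 [simp]: "additive_char R 0 = 1"
  by (simp add: additive_char_def)

lemma additive_char_add: "additive_char R (m + n) = additive_char R m * additive_char R n"
  by (simp add: additive_char_def cis_mult add_divide_distrib distrib_left)

lemma cnj_additive_char: "cnj (additive_char R n) = additive_char R (- n)"
  by (simp add: additive_char_def cis_cnj)

lemma additive_char_eq_1: "R dvd n \<Longrightarrow> additive_char R n = 1"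
  unfolding additive_char_def by (rule cis_multiple_2pi) (auto elim!: dvdE)

text \<open>Only the off-diagonal part of one half of unitarity is recorded. Being one-sided, the
  same notion serves rows and columns by swapping \<open>B\<close> and \<open>L\<close>.\<close>

definition char_orthogonal :: "int \<Rightarrow> int set \<Rightarrow> int set \<Rightarrow> bool" where
  "char_orthogonal R B L \<longleftrightarrow>
     (\<forall>b\<in>B. \<forall>b'\<in>B. b \<noteq> b' \<longrightarrow> (\<Sum>l\<in>L. additive_char R ((b - b') * l)) = 0)"

lemma char_orthogonalD:
  assumes "char_orthogonal R B L" "b \<in> B" "b' \<in> B" "b \<noteq> b'"
  shows "(\<Sum>l\<in>L. additive_char R ((b - b') * l)) = 0"
  using assms by (auto simp: char_orthogonal_def)

lemma hadamard_matrix_mult_cnj: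
  "hadamard_matrix R N b l * cnj (hadamard_matrix R N b' l')
     = additive_char R (b * l - b' * l') / of_nat N"
proof -
  have matrix_eq:
    "hadamard_matrix R N b l = 1 / complex_of_real (sqrt (real N)) * additive_char R (b * l)" for b l
    by (simp add: hadamard_matrix_def additive_char_def cis_conv_exp field_simps)
  have "complex_of_real (sqrt (real N)) * complex_of_real (sqrt (real N)) = of_nat N"
    by (simp flip: of_real_mult)
  then show ?thesis
    using additive_char_add[of R "b * l" "- (b' * l')"]
    by (simp add: matrix_eq cnj_additive_char)
qed

text \<open>On the diagonal each of the N summands is 1/N, so the norm condition is automatic and
  only the vanishing of the off-diagonal sums remains.\<close>

lemma hadamard_rows_orthonormal_iff:
  assumes "card L = N" "N > 0"
  shows "(\<forall>b\<in>B. \<forall>b'\<in>B. (\<Sum>l\<in>L. hadamard_matrix R N b l * cnj (hadamard_matrix R N b' l))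
            = (if b = b' then 1 else 0)) \<longleftrightarrow> char_orthogonal R B L"
proof -
  have "(\<Sum>l\<in>L. hadamard_matrix R N b l * cnj (hadamard_matrix R N b' l))
      = (\<Sum>l\<in>L. additive_char R ((b - b') * l)) / of_nat N" for b b'
    by (simp add: hadamard_matrix_mult_cnj sum_divide_distrib left_diff_distrib)
  then show ?thesis
    using assms by (auto simp: char_orthogonal_def)
qed

lemma hadamard_matrix_commute: "hadamard_matrix R N b l = hadamard_matrix R N l b"
  by (simp add: hadamard_matrix_def mult.assoc mult.commute[of "of_int b"])

text \<open>The matrix entry is symmetric in b and l, so the columns for (B, L) are the rows for (L,
  B).\<close>

lemma hadamard_columns_orthonormal_iff:
  assumes "card B = N" "N > 0"
  shows "(\<forall>l\<in>L. \<forall>l'\<in>L. (\<Sum>b\<in>B. cnj (hadamard_matrix R N b l) * hadamard_matrix R N b l')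
            = (if l = l' then 1 else 0)) \<longleftrightarrow> char_orthogonal R L B"
proof -
  have "(\<Sum>b\<in>B. cnj (hadamard_matrix R N b l) * hadamard_matrix R N b l')
      = (\<Sum>b\<in>B. hadamard_matrix R N l' b * cnj (hadamard_matrix R N l b))" for l l'
    by (simp add: hadamard_matrix_commute[of R N l] hadamard_matrix_commute[of R N l'] mult.commute)
  then show ?thesis
    unfolding hadamard_rows_orthonormal_iff[OF assms, symmetric] by auto
qed

lemma hadamard_pair_iff:
  "hadamard_pair R B L \<longleftrightarrow>
     R \<ge> 2 \<and> finite B \<and> finite L \<and> 0 \<in> B \<and> 0 \<in> L \<and> card B = card L \<and>
     char_orthogonal R B L \<and> char_orthogonal R L B"
proof (cases "finite B \<and> 0 \<in> B \<and> card B = card L")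
  case True
  then have "card B > 0"
    by (metis card_gt_0_iff empty_iff)
  \<comment> \<open>Infinite sets have cardinality 0, so positivity of \<open>card L\<close> forces
    finiteness.\<close>
  moreover from this True have "finite L"
    by (metis card_ge_0_finite)
  ultimately show ?thesis using True
    unfolding hadamard_pair_def unitary_on_def
    using hadamard_rows_orthonormal_iff[of L "card B" B R]
      hadamard_columns_orthonormal_iff[of B "card B" L R] by auto
qed (auto simp: hadamard_pair_def)

lemma disjoint_differences_commute: "disjoint_differences A A' \<longleftrightarrow> disjoint_differences A' A"
  by (simp add: disjoint_differences_def Int_commute)

text \<open>Two representations of one element give a common difference a - c = c' - a', which must
  be 0.\<close>

lemma disjoint_differences_inj_on:
  assumes "disjoint_differences A A'"
  shows "inj_on (\<lambda>(a, a'). a + a') (A \<times> A')"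
proof (rule inj_onI, clarsimp)
  fix a a' c c'
  assume mem: "a \<in> A" "a' \<in> A'" "c \<in> A" "c' \<in> A'" and eq: "a + a' = c + c'"
  have diff: "a - c = c' - a'"
    using eq by (simp add: algebra_simps)
  have "a - c \<in> difference_set A" "c' - a' \<in> difference_set A'"
    using mem by (auto simp: difference_set_def)
  with diff have "a - c \<in> difference_set A \<inter> difference_set A'"
    by simp
  with assms have "a - c = 0"
    unfolding disjoint_differences_def by blast
  with diff show "a = c \<and> a' = c'"
    by simp
qed

lemma char_orthogonal_imp_disjoint_differences:
  assumes orth: "char_orthogonal R F G" and "finite G" "G \<noteq> {}" "B \<noteq> {}" "F \<noteq> {}"
    and dvd: "\<forall>b\<in>B. \<forall>g\<in>G. R dvd b * g"
  shows "disjoint_differences B F"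
proof -
  have "b - b' = 0" if mem: "b \<in> B" "b' \<in> B" "f \<in> F" "f' \<in> F" and eq: "b - b' = f - f'" for b b' f f'
  proof (rule ccontr)
    assume "b - b' \<noteq> 0"
    then have "(\<Sum>g\<in>G. additive_char R ((f - f') * g)) = 0"
      using mem eq by (intro char_orthogonalD[OF orth]) auto
    moreover have "additive_char R ((f - f') * g) = 1" if "g \<in> G" for g
      using dvd that mem unfolding eq[symmetric]
      by (intro additive_char_eq_1) (simp add: left_diff_distrib)
    ultimately show False
      using \<open>finite G\<close> \<open>G \<noteq> {}\<close> by simp
  qed
  then have "difference_set B \<inter> difference_set F \<subseteq> {0}"
    unfolding difference_set_def by blast
  moreover have "0 \<in> difference_set A" if "A \<noteq> {}" for A :: "int set"
    using that by (force simp: difference_set_def)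
  ultimately show ?thesis
    using \<open>B \<noteq> {}\<close> \<open>F \<noteq> {}\<close> unfolding disjoint_differences_def by blast
qed

text \<open>Reindexing along addition, which is injective on the product.\<close>

lemma sum_set_plus:
  assumes "disjoint_differences L G"
  shows "(\<Sum>x\<in>L + G. h x) = (\<Sum>l\<in>L. \<Sum>g\<in>G. h (l + g))"
  unfolding set_plus_image
  by (subst sum.reindex[OF disjoint_differences_inj_on[OF assms]])
    (simp add: sum.cartesian_product case_prod_unfold)

lemma card_set_plus:
  assumes "disjoint_differences A A'"
  shows "card (A + A') = card A * card A'"
  unfolding set_plus_image
  by (simp add: card_image[OF disjoint_differences_inj_on[OF assms]] card_cartesian_product)

lemma char_orthogonal_set_plus:
  assumes BL: "char_orthogonal R B L" and FG: "char_orthogonal R F G"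
    and dvd: "\<forall>b\<in>B. \<forall>g\<in>G. R dvd b * g"
    and disj: "disjoint_differences L G"
  shows "char_orthogonal R (B + F) (L + G)"
  unfolding char_orthogonal_def
proof (intro ballI impI)
  fix x x' assume "x \<in> B + F" "x' \<in> B + F" and neq: "x \<noteq> x'"
  then obtain b f b' f' where
    x: "x = b + f" "b \<in> B" "f \<in> F" and x': "x' = b' + f'" "b' \<in> B" "f' \<in> F"
    by (auto elim!: set_plus_elim)
  \<comment> \<open>Divisibility removes only the cross term (b - b') g. Nothing is known about (f -
    f') l, so the first factor keeps x - x'.\<close>
  have split: "additive_char R ((x - x') * (l + g))
      = additive_char R ((x - x') * l) * additive_char R ((f - f') * g)" if "g \<in> G" for l g
  proof -
    have eq: "(x - x') * (l + g) = (x - x') * l + (f - f') * g + (b - b') * g"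
      by (simp add: x x' algebra_simps)
    have "additive_char R ((b - b') * g) = 1"
      using dvd that x x' by (intro additive_char_eq_1) (simp add: left_diff_distrib)
    then show ?thesis
      by (simp add: eq additive_char_add)
  qed
  have "(\<Sum>y\<in>L + G. additive_char R ((x - x') * y))
      = (\<Sum>l\<in>L. additive_char R ((x - x') * l)) * (\<Sum>g\<in>G. additive_char R ((f - f') * g))"
    by (simp add: sum_set_plus[OF disj] split sum_product)
  also have "\<dots> = 0"
  proof (cases "f = f'")
    case True
    then have "(\<Sum>l\<in>L. additive_char R ((b - b') * l)) = 0"
      using neq x x' by (intro char_orthogonalD[OF BL]) auto
    with True show ?thesis
      by (simp add: x x')
  next
    case False
    then show ?thesis
      using char_orthogonalD[OF FG] x x' by simp
  qed
  finally show "(\<Sum>y\<in>L + G. additive_char R ((x - x') * y)) = 0" .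
qed

theorem proposition1p23:
  fixes R :: int and B L F G :: "int set"
  assumes "hadamard_pair R B L"
    and "hadamard_pair R F G"
    and "\<forall>b\<in>B. \<forall>g\<in>G. R dvd b * g"
  shows "disjoint_differences B F \<and> disjoint_differences L G \<and>
         hadamard_pair R (B + F) (L + G)"
proof -
  have BL: "R \<ge> 2" "finite B" "finite L" "0 \<in> B" "0 \<in> L" "card B = card L"
      "char_orthogonal R B L" "char_orthogonal R L B"
    and FG: "finite F" "finite G" "0 \<in> F" "0 \<in> G" "card F = card G"
      "char_orthogonal R F G" "char_orthogonal R G F"
    using assms(1,2) by (auto simp: hadamard_pair_iff)
  have dvd': "\<forall>g\<in>G. \<forall>b\<in>B. R dvd g * b"
    using assms(3) by (metis mult.commute)
  have BF: "disjoint_differences B F"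
    using BL FG assms(3) by (intro char_orthogonal_imp_disjoint_differences[of R F G B]) auto
  \<comment> \<open>Here (L, B) plays the role of (F, G), and G that of B.\<close>
  have GL: "disjoint_differences G L"
    using BL FG dvd' by (intro char_orthogonal_imp_disjoint_differences[of R L B G]) auto
  then have LG: "disjoint_differences L G"
    by (simp add: disjoint_differences_commute)
  have "char_orthogonal R (B + F) (L + G)"
    using BL FG assms(3) LG by (intro char_orthogonal_set_plus)
  \<comment> \<open>The order of the summands matters for applying the rule: G must come first,
    since divisibility links it to B. Commutativity of set addition restores the order at the
    end.\<close>
  moreover have "char_orthogonal R (G + L) (F + B)"
    using BL FG dvd' BF by (intro char_orthogonal_set_plus) (auto simp: disjoint_differences_commute)
  moreover have "0 \<in> B + F" "0 \<in> L + G"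
    using BL FG set_plus_intro[of 0 B 0 F] set_plus_intro[of 0 L 0 G] by auto
  moreover have "card (B + F) = card (L + G)"
    using BL FG BF LG by (simp add: card_set_plus)
  ultimately show ?thesis
    using BL FG BF LG by (simp add: hadamard_pair_iff finite_set_plus add.commute)
qed

end
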